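(* Consider the sequence of Markov chains $X_{(d)}$ indexed by $d=1,2,\ldots$ on $\mathbb E_{(d)}=\{0,1\}^d$ with initial distribution $\nu_{(d)}=\delta_{(0,\ldots,0)}$ and transition matrix $$\mathbf P_{(d)}(\mathbf i^{(1)},\mathbf i^{(2)})=\begin{cases} a_kp_k & \text{if } \mathbf i^{(2)}=\mathbf i^{(1)}+\mathbf s_k,\\ 1-\displaystyle\sum_{j:\,i^{(1)}_j=0}a_jp_j-\sum_{j:\,i^{(1)}_j=1}(1-a_j)p_j & \text{if } \mathbf i^{(2)}=\mathbf i^{(1)},\\ (1-a_k)p_k & \text{if } \mathbf i^{(2)}=\mathbf i^{(1)}-\mathbf s_k \end{cases}$$ (all other entries $0$), with $p_k=\frac1d$ and any $a_k\in(0,1)$, $k=1,\ldots,d$. The stationary distribution is $\pi_{(d)}(\mathbf i)=\prod_{j=1}^d[a_j\mathbf 1(i_j=1)+(1-a_j)\mathbf 1(i_j=0)]$. The sequence exhibits a separation cutoff at time $d\log d$ with window size $d$.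
   Context: $\mathbf i^{(r)}=(i^{(r)}_1,\ldots,i^{(r)}_d)$; $\mathbf s_k=(0,\ldots,0,1,0,\ldots,0)$ with $1$ at position $k$. Separation: $sep(\mu,\pi)=\max_{\mathbf e}(1-\mu(\mathbf e)/\pi(\mathbf e))$. A sequence of ergodic chains $X_{(d)}\sim(\nu_{(d)},\mathbf P_{(d)})$ with stationary distributions $\pi_{(d)}$ exhibits a separation cutoff at time $t_d$ with window size $w_d=o(t_d)$ if $$\lim_{c\to\infty}\limsup_{d\to\infty}sep(\nu_{(d)}\mathbf P_{(d)}^{t_d+cw_d},\pi_{(d)})=0,\qquad \lim_{c\to\infty}\liminf_{d\to\infty}sep(\nu_{(d)}\mathbf P_{(d)}^{t_d-cw_d},\pi_{(d)})=1,$$ where non-integer exponents are replaced by their integer parts (floor), and only large $d$ matter. *)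

theory Defs
  imports Complex_Main "HOL-Library.Extended_Real" "HOL-Library.Landau_Symbols"
begin

text \<open>
  A finite Markov chain is given by a finite state set \<open>E\<close>, an initial distribution \<open>\<nu>\<close> and a
  transition matrix \<open>P\<close>. Only the values of \<open>\<nu>\<close> and \<open>P\<close> on \<open>E\<close> matter.
\<close>

definition distribution_on :: "'s set \<Rightarrow> ('s \<Rightarrow> real) \<Rightarrow> bool" where
  "distribution_on E \<mu> \<longleftrightarrow> (\<forall>x\<in>E. 0 \<le> \<mu> x) \<and> (\<Sum>x\<in>E. \<mu> x) = 1"

definition markov_chain :: "'s set \<Rightarrow> ('s \<Rightarrow> real) \<Rightarrow> ('s \<Rightarrow> 's \<Rightarrow> real) \<Rightarrow> bool" where
  "markov_chain E \<nu> P \<longleftrightarrow>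
     finite E \<and> distribution_on E \<nu> \<and> (\<forall>x\<in>E. distribution_on E (P x))"

primrec matpow :: "'s set \<Rightarrow> ('s \<Rightarrow> 's \<Rightarrow> real) \<Rightarrow> nat \<Rightarrow> 's \<Rightarrow> 's \<Rightarrow> real" where
  "matpow E P 0 = (\<lambda>x y. if x = y then 1 else 0)"
| "matpow E P (Suc n) = (\<lambda>x y. \<Sum>z\<in>E. matpow E P n x z * P z y)"

definition vecmat :: "'s set \<Rightarrow> ('s \<Rightarrow> real) \<Rightarrow> ('s \<Rightarrow> 's \<Rightarrow> real) \<Rightarrow> 's \<Rightarrow> real" where
  "vecmat E \<mu> M y = (\<Sum>x\<in>E. \<mu> x * M x y)"

definition irreducible_chain :: "'s set \<Rightarrow> ('s \<Rightarrow> 's \<Rightarrow> real) \<Rightarrow> bool" where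
  "irreducible_chain E P \<longleftrightarrow> (\<forall>x\<in>E. \<forall>y\<in>E. \<exists>n. matpow E P n x y > 0)"

definition aperiodic_chain :: "'s set \<Rightarrow> ('s \<Rightarrow> 's \<Rightarrow> real) \<Rightarrow> bool" where
  "aperiodic_chain E P \<longleftrightarrow> (\<forall>x\<in>E. Gcd {n::nat. n > 0 \<and> matpow E P n x x > 0} = 1)"

definition ergodic_chain :: "'s set \<Rightarrow> ('s \<Rightarrow> real) \<Rightarrow> ('s \<Rightarrow> 's \<Rightarrow> real) \<Rightarrow> bool" where
  "ergodic_chain E \<nu> P \<longleftrightarrow>
     markov_chain E \<nu> P \<and> irreducible_chain E P \<and> aperiodic_chain E P"

definition stationary_distribution :: "'s set \<Rightarrow> ('s \<Rightarrow> 's \<Rightarrow> real) \<Rightarrow> ('s \<Rightarrow> real) \<Rightarrow> bool" where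
  "stationary_distribution E P \<pi> \<longleftrightarrow>
     distribution_on E \<pi> \<and> (\<forall>y\<in>E. vecmat E \<pi> P y = \<pi> y)"

definition sep :: "'s set \<Rightarrow> ('s \<Rightarrow> real) \<Rightarrow> ('s \<Rightarrow> real) \<Rightarrow> real" where
  "sep E \<mu> \<pi> = Max ((\<lambda>e. 1 - \<mu> e / \<pi> e) ` E)"

text \<open>
  Real exponents are rounded down. \<open>nat\<close> sends a negative exponent to 0; since
  \<open>w\<close> is \<open>o(t)\<close>, for each \<open>c\<close> this affects only finitely many \<open>d\<close> when \<open>t\<close> is eventually positive.
\<close>

definition sep_at ::
  "'s set \<Rightarrow> ('s \<Rightarrow> real) \<Rightarrow> ('s \<Rightarrow> 's \<Rightarrow> real) \<Rightarrow> ('s \<Rightarrow> real) \<Rightarrow> real \<Rightarrow> real" where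
  "sep_at E \<nu> P \<pi> r = sep E (vecmat E \<nu> (matpow E P (nat \<lfloor>r\<rfloor>))) \<pi>"

text \<open>Chains are indexed by \<open>d \<ge> 1\<close>; the index 0 plays no role.\<close>

definition separation_cutoff ::
  "(nat \<Rightarrow> 's set) \<Rightarrow> (nat \<Rightarrow> 's \<Rightarrow> real) \<Rightarrow> (nat \<Rightarrow> 's \<Rightarrow> 's \<Rightarrow> real) \<Rightarrow> (nat \<Rightarrow> 's \<Rightarrow> real)
     \<Rightarrow> (nat \<Rightarrow> real) \<Rightarrow> (nat \<Rightarrow> real) \<Rightarrow> bool" where
  "separation_cutoff E \<nu> P \<pi> t w \<longleftrightarrow>
     (\<forall>d\<ge>1. ergodic_chain (E d) (\<nu> d) (P d) \<and> stationary_distribution (E d) (P d) (\<pi> d)) \<and>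
     w \<in> o(t) \<and>
     ((\<lambda>c::real. limsup (\<lambda>d. ereal (sep_at (E d) (\<nu> d) (P d) (\<pi> d) (t d + c * w d))))
        \<longlongrightarrow> 0) at_top \<and>
     ((\<lambda>c::real. liminf (\<lambda>d. ereal (sep_at (E d) (\<nu> d) (P d) (\<pi> d) (t d - c * w d))))
        \<longlongrightarrow> 1) at_top"

text \<open>
  A vector in \<open>{0,1}\<^sup>d\<close> is a function on \<open>nat\<close> with coordinates \<open>1, \<dots>, d\<close> and value 0
  at all other arguments. Integer values keep the subtraction of unit vectors from truncating.
\<close>

definition cube :: "nat \<Rightarrow> (nat \<Rightarrow> int) set" where
  "cube d = {i. (\<forall>k\<in>{1..d}. i k \<in> {0, 1}) \<and> (\<forall>k. k \<notin> {1..d} \<longrightarrow> i k = 0)}"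

definition unit_vec :: "nat \<Rightarrow> nat \<Rightarrow> int" where
  "unit_vec k = (\<lambda>j. if j = k then 1 else 0)"

definition point_mass :: "'s \<Rightarrow> 's \<Rightarrow> real" where
  "point_mass x y = (if y = x then 1 else 0)"

text \<open>
  For \<open>j \<noteq> i\<close> at most one summand below is nonzero, because \<open>j - i\<close> equals \<open>unit_vec k\<close>
  or its negative for at most one \<open>k\<close>.
\<close>

definition cube_trans ::
  "nat \<Rightarrow> (nat \<Rightarrow> real) \<Rightarrow> (nat \<Rightarrow> real) \<Rightarrow> (nat \<Rightarrow> int) \<Rightarrow> (nat \<Rightarrow> int) \<Rightarrow> real" where
  "cube_trans d a p i j =
     (if j = i then
        1 - (\<Sum>k | k \<in> {1..d} \<and> i k = 0. a k * p k)
          - (\<Sum>k | k \<in> {1..d} \<and> i k = 1. (1 - a k) * p k)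
      else
        (\<Sum>k\<in>{1..d}. (if j = (\<lambda>l. i l + unit_vec k l) then a k * p k
                     else if j = (\<lambda>l. i l - unit_vec k l) then (1 - a k) * p k
                     else 0)))"

definition cube_stat :: "nat \<Rightarrow> (nat \<Rightarrow> real) \<Rightarrow> (nat \<Rightarrow> int) \<Rightarrow> real" where
  "cube_stat d a i =
     (\<Prod>j\<in>{1..d}. a j * of_bool (i j = 1) + (1 - a j) * of_bool (i j = 0))"

end

theory Submission
  imports Defs "HOL-Library.FuncSet" "HOL-Real_Asymp.Real_Asymp"
begin

text \<open>
  One step of the chain picks a coordinate uniformly at random and replaces its value by an
  independent coin: coordinate \<open>k\<close> becomes 1 with probability \<open>a k\<close> and 0 otherwise. Hence, given the
  word \<open>w\<close> of coordinates picked during the first \<open>n\<close> steps, the coordinates in \<open>set w\<close> are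
  independent coins and the others still have their initial values. Since the order and the
  multiplicity of the picks do not matter, the \<open>n\<close>-step matrix is the average, over all words of
  length \<open>n\<close>, of the kernel \<open>refresh\<close> of \<open>set w\<close> (\<open>matpow_cube_trans\<close>). Ergodicity and stationarity
  are read off from this representation.

  A word that contains every coordinate contributes exactly the stationary distribution. Started
  from the zero vector, the chain is at the all-ones vector only if every coordinate has been picked,
  so the worst ratio to the stationary distribution is attained there, and the separation equals
  the probability that \<open>n\<close> uniform picks have not yet collected all \<open>d\<close> coupons
  (\<open>sep_eq_cover_prob\<close>). In particular it does not depend on \<open>a\<close>.

  Let \<open>m = d (1 - 1/d)\<^sup>n\<close> be the expected number of missing coupons. The union bound gives
  \<open>sep \<le> m\<close>. The events that two different coupons are missing are negatively correlated, so the
  variance of the number of missing coupons is at most \<open>m\<close>, and Chebyshev's inequality gives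
  \<open>1 - sep \<le> 1/m\<close> (\<open>cover_prob_bounds\<close>). At time \<open>d log d + c d\<close> the number \<open>m\<close> tends to
  \<open>exp (-c)\<close>, so the separation is asymptotically at most \<open>exp (-c)\<close> there, and at time
  \<open>d log d - c d\<close> at least \<open>1 - exp (-c)\<close>.
\<close>

section \<open>Refreshing coordinates of the cube\<close>

definition coin :: "real \<Rightarrow> int \<Rightarrow> real" where
  "coin p v = p * of_bool (v = 1) + (1 - p) * of_bool (v = 0)"

text \<open>
  The probability of moving from \<open>x\<close> to \<open>y\<close> when the coordinates in \<open>R\<close> are tossed afresh,
  independently, and the others are kept.
\<close>

definition refresh ::
  "nat \<Rightarrow> (nat \<Rightarrow> real) \<Rightarrow> nat set \<Rightarrow> (nat \<Rightarrow> int) \<Rightarrow> (nat \<Rightarrow> int) \<Rightarrow> real" where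
  "refresh d a R x y = (\<Prod>j\<in>{1..d}. if j \<in> R then coin (a j) (y j) else of_bool (y j = x j))"

lemma bij_betw_cube_PiE:
  "bij_betw (\<lambda>x. restrict x {1..d}) (cube d) (PiE {1..d} (\<lambda>_. {0, 1}))"
proof (rule bij_betw_byWitness[where f' = "\<lambda>g k. if k \<in> {1..d} then g k else 0"])
  show "\<forall>x\<in>cube d. (\<lambda>k. if k \<in> {1..d} then restrict x {1..d} k else 0) = x"
    by (force simp: cube_def)
  show "\<forall>g\<in>PiE {1..d} (\<lambda>_. {0, 1::int}). restrict (\<lambda>k. if k \<in> {1..d} then g k else 0) {1..d} = g"
    by (auto simp: PiE_def extensional_def restrict_def fun_eq_iff)
  show "(\<lambda>x. restrict x {1..d}) ` cube d \<subseteq> PiE {1..d} (\<lambda>_. {0, 1})"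
    by (auto simp: cube_def)
  show "(\<lambda>g k. if k \<in> {1..d} then g k else 0) ` PiE {1..d} (\<lambda>_. {0, 1}) \<subseteq> cube d"
    by (force simp: cube_def PiE_def Pi_def)
qed

lemma finite_cube: "finite (cube d)"
  using bij_betw_finite[OF bij_betw_cube_PiE[of d]] by (simp add: finite_PiE)

text \<open>
  All kernels below are products over the coordinates, so this exchange of sum and product reduces
  every sum over the cube to a computation in a single coordinate.
\<close>

lemma sum_cube_prod:
  fixes F :: "nat \<Rightarrow> int \<Rightarrow> real"
  shows "(\<Sum>x\<in>cube d. \<Prod>j\<in>{1..d}. F j (x j)) = (\<Prod>j\<in>{1..d}. F j 0 + F j 1)"
proof -
  have "(\<Sum>x\<in>cube d. \<Prod>j\<in>{1..d}. F j (x j))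
      = (\<Sum>x\<in>cube d. \<Prod>j\<in>{1..d}. F j (restrict x {1..d} j))"
    by simp
  also have "\<dots> = (\<Sum>g\<in>PiE {1..d} (\<lambda>_. {0, 1}). \<Prod>j\<in>{1..d}. F j (g j))"
    by (rule sum.reindex_bij_betw[OF bij_betw_cube_PiE])
  also have "\<dots> = (\<Prod>j\<in>{1..d}. \<Sum>v\<in>{0, 1}. F j v)"
    by (subst prod_sum_PiE) auto
  finally show ?thesis by simp
qed

lemma cubeD: "x \<in> cube d \<Longrightarrow> j \<in> {1..d} \<Longrightarrow> x j = 0 \<or> x j = 1"
  by (auto simp: cube_def)

lemma refresh_empty:
  assumes "x \<in> cube d" "y \<in> cube d"
  shows "refresh d a {} x y = (if x = y then 1 else 0)"
proof (cases "x = y")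
  case False
  then obtain j where j: "x j \<noteq> y j" by blast
  with assms have "j \<in> {1..d}" by (force simp: cube_def)
  with j False show ?thesis
    unfolding refresh_def by (auto intro!: prod_zero bexI[of _ j])
qed (simp add: refresh_def)

lemma refresh_all: "{1..d} \<subseteq> R \<Longrightarrow> refresh d a R x y = cube_stat d a y"
  unfolding refresh_def cube_stat_def coin_def by (rule prod.cong) auto

text \<open>
  A coordinate that is tossed twice only remembers the last toss, so composing refreshes takes the
  union of the index sets. This is why only the set of picked coordinates matters.
\<close>

lemma refresh_comp:
  assumes x: "x \<in> cube d" and y: "y \<in> cube d"
  shows "(\<Sum>z\<in>cube d. refresh d a R x z * refresh d a S z y) = refresh d a (R \<union> S) x y"
proof -
  define F where "F j v = (if j \<in> R then coin (a j) v else of_bool (v = x j)) *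
    (if j \<in> S then coin (a j) (y j) else of_bool (y j = v))" for j v
  have "(\<Sum>z\<in>cube d. refresh d a R x z * refresh d a S z y)
      = (\<Sum>z\<in>cube d. \<Prod>j\<in>{1..d}. F j (z j))"
    by (simp add: refresh_def F_def prod.distrib)
  also have "\<dots> = (\<Prod>j\<in>{1..d}. F j 0 + F j 1)"
    by (rule sum_cube_prod)
  also have "\<dots> = refresh d a (R \<union> S) x y"
    unfolding F_def refresh_def
  proof (rule prod.cong[OF refl], goal_cases)
    case (1 j)
    with cubeD[OF x 1] cubeD[OF y 1] show ?case
      by (auto simp: coin_def algebra_simps)
  qed
  finally show ?thesis .
qed

lemma refresh_sum:
  assumes x: "x \<in> cube d"
  shows "(\<Sum>y\<in>cube d. refresh d a R x y) = 1"
proof -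
  have "(\<Sum>y\<in>cube d. refresh d a R x y)
      = (\<Prod>j\<in>{1..d}. (if j \<in> R then coin (a j) 0 else of_bool (0 = x j))
                    + (if j \<in> R then coin (a j) 1 else of_bool (1 = x j)))"
    unfolding refresh_def
    by (rule sum_cube_prod[of "\<lambda>j v. if j \<in> R then coin (a j) v else of_bool (v = x j)"])
  also have "\<dots> = 1"
  proof (rule prod.neutral, intro ballI, goal_cases)
    case (1 j)
    with cubeD[OF x 1] show ?case by (auto simp: coin_def)
  qed
  finally show ?thesis .
qed

lemma refresh_nonneg:
  assumes "\<forall>k\<in>{1..d}. 0 < a k \<and> a k < 1"
  shows "0 \<le> refresh d a R x y"
  unfolding refresh_def coin_def using assms by (force intro: prod_nonneg)

lemma cube_stat_pos:
  assumes "\<forall>k\<in>{1..d}. 0 < a k \<and> a k < 1" "y \<in> cube d"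
  shows "0 < cube_stat d a y"
  unfolding cube_stat_def using assms cubeD[of y d] by (force intro!: prod_pos)

lemma refresh_self_pos:
  assumes "\<forall>k\<in>{1..d}. 0 < a k \<and> a k < 1" "x \<in> cube d"
  shows "0 < refresh d a R x x"
  unfolding refresh_def coin_def using assms cubeD[of x d] by (force intro!: prod_pos)

section \<open>The transition matrix as a random refresh\<close>

lemma refresh_singleton:
  assumes k: "k \<in> {1..d}"
  shows "refresh d a {k} x y = coin (a k) (y k) * of_bool (\<forall>j\<in>{1..d} - {k}. y j = x j)"
proof -
  have "refresh d a {k} x y = coin (a k) (y k) * (\<Prod>j\<in>{1..d} - {k}. of_bool (y j = x j))"
    unfolding refresh_def by (subst prod.remove[OF _ k]) (auto intro!: prod.cong)
  also have "(\<Prod>j\<in>{1..d} - {k}. of_bool (y j = x j)) = (of_bool (\<forall>j\<in>{1..d} - {k}. y j = x j) :: real)"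
    by (auto intro!: prod_zero)
  finally show ?thesis .
qed

text \<open>
  The holding probability of the chain is the chance that the coin tossed for the picked coordinate
  reproduces the current value.
\<close>

lemma cube_trans_eq_refresh:
  assumes d: "d \<ge> 1" and x: "x \<in> cube d" and y: "y \<in> cube d"
  shows "cube_trans d a (\<lambda>k. 1 / real d) x y = (\<Sum>k\<in>{1..d}. refresh d a {k} x y) / real d"
proof (cases "y = x")
  case True
  have "(\<Sum>k\<in>{1..d}. refresh d a {k} x y)
      = (\<Sum>k\<in>{1..d}. 1 - (if x k = 0 then a k else 0) - (if x k = 1 then 1 - a k else 0))"
  proof (rule sum.cong[OF refl], goal_cases)
    case (1 k)
    with cubeD[OF x 1] True show ?case by (auto simp: refresh_singleton[OF 1] coin_def)
  qed
  also have "\<dots> = real d - (\<Sum>k | k \<in> {1..d} \<and> x k = 0. a k)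
                   - (\<Sum>k | k \<in> {1..d} \<and> x k = 1. 1 - a k)"
    by (simp only: sum.inter_filter[OF finite_atLeastAtMost]) (simp add: sum_subtractf)
  finally show ?thesis
    using True d by (simp add: cube_trans_def diff_divide_distrib sum_divide_distrib)
next
  case False
  have "cube_trans d a (\<lambda>k. 1 / real d) x y =
     (\<Sum>k\<in>{1..d}. refresh d a {k} x y / real d)"
    unfolding cube_trans_def using False
  proof (simp only: if_False, intro sum.cong refl, goal_cases)
    case (1 k)
    note k = \<open>k \<in> {1..d}\<close>
    have off: "y j = x j" if "j \<notin> {1..d}" for j
      using that x y by (simp add: cube_def)
    have up: "y = (\<lambda>l. x l + unit_vec k l) \<longleftrightarrow> (\<forall>j\<in>{1..d} - {k}. y j = x j) \<and> y k = 1"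
    proof
      assume "y = (\<lambda>l. x l + unit_vec k l)"
      then have *: "y l = x l + unit_vec k l" for l by simp
      then show "(\<forall>j\<in>{1..d} - {k}. y j = x j) \<and> y k = 1"
        using cubeD[OF x k] cubeD[OF y k] *[of k] by (auto simp: unit_vec_def)
    next
      assume r: "(\<forall>j\<in>{1..d} - {k}. y j = x j) \<and> y k = 1"
      then have eq: "y l = x l" if "l \<noteq> k" for l using that off[of l] by blast
      with False have "x k \<noteq> y k" by (metis ext)
      with r eq cubeD[OF x k] show "y = (\<lambda>l. x l + unit_vec k l)"
        by (auto simp: unit_vec_def)
    qed
    have down: "y = (\<lambda>l. x l - unit_vec k l) \<longleftrightarrow> (\<forall>j\<in>{1..d} - {k}. y j = x j) \<and> y k = 0"
    proof
      assume "y = (\<lambda>l. x l - unit_vec k l)"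
      then have *: "y l = x l - unit_vec k l" for l by simp
      then show "(\<forall>j\<in>{1..d} - {k}. y j = x j) \<and> y k = 0"
        using cubeD[OF x k] cubeD[OF y k] *[of k] by (auto simp: unit_vec_def)
    next
      assume r: "(\<forall>j\<in>{1..d} - {k}. y j = x j) \<and> y k = 0"
      then have eq: "y l = x l" if "l \<noteq> k" for l using that off[of l] by blast
      with False have "x k \<noteq> y k" by (metis ext)
      with r eq cubeD[OF x k] show "y = (\<lambda>l. x l - unit_vec k l)"
        by (auto simp: unit_vec_def)
    qed
    show ?case
      unfolding up down refresh_singleton[OF k] coin_def using cubeD[OF y k] by auto
  qed
  then show ?thesis by (simp add: sum_divide_distrib)
qed

lemma sum_words_Suc:
  assumes "finite A"
  shows "(\<Sum>w | set w \<subseteq> A \<and> length w = Suc n. f w)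
       = (\<Sum>w | set w \<subseteq> A \<and> length w = n. \<Sum>k\<in>A. f (k # w) :: real)"
  unfolding lists_length_Suc_eq
  by (subst sum.reindex) (auto simp: inj_on_def sum.cartesian_product intro!: sum.cong)

text \<open>
  Each step averages over one refreshed coordinate, and the kernels compose by union, so \<open>n\<close> steps
  average over words of length \<open>n\<close>. With the starting point \<open>x\<close> arbitrary, the formula yields
  irreducibility and aperiodicity as well as the law of the chain started at zero.
\<close>

lemma matpow_cube_trans:
  assumes d: "d \<ge> 1" and x: "x \<in> cube d" and y: "y \<in> cube d"
  shows "matpow (cube d) (cube_trans d a (\<lambda>k. 1 / real d)) n x y
       = (\<Sum>w | set w \<subseteq> {1..d} \<and> length w = n. refresh d a (set w) x y) / real d ^ n"
  using y
proof (induction n arbitrary: y)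
  case 0
  have "{w. set w \<subseteq> {1..d} \<and> length w = 0} = {[]}" by auto
  then show ?case using refresh_empty[OF x 0] by simp
next
  case (Suc n)
  let ?W = "{w. set w \<subseteq> {1..d} \<and> length w = n}"
  have "matpow (cube d) (cube_trans d a (\<lambda>k. 1 / real d)) (Suc n) x y
      = (\<Sum>z\<in>cube d. (\<Sum>w\<in>?W. refresh d a (set w) x z) / real d ^ n
                     * ((\<Sum>k\<in>{1..d}. refresh d a {k} z y) / real d))"
    using Suc cube_trans_eq_refresh[OF d _ Suc.prems] by (simp add: mult.commute)
  also have "\<dots> = (\<Sum>z\<in>cube d. \<Sum>w\<in>?W. \<Sum>k\<in>{1..d}.
                     refresh d a (set w) x z * refresh d a {k} z y) / real d ^ Suc n"
    by (simp only: sum_product times_divide_times_eq sum_divide_distrib power_Suc2)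
  also have "(\<Sum>z\<in>cube d. \<Sum>w\<in>?W. \<Sum>k\<in>{1..d}. refresh d a (set w) x z * refresh d a {k} z y)
      = (\<Sum>w\<in>?W. \<Sum>k\<in>{1..d}. \<Sum>z\<in>cube d. refresh d a (set w) x z * refresh d a {k} z y)"
    by (subst sum.swap) (intro sum.cong refl sum.swap)
  also have "\<dots> = (\<Sum>w\<in>?W. \<Sum>k\<in>{1..d}. refresh d a (set (k # w)) x y)"
    using refresh_comp[OF x Suc.prems] by simp
  also have "\<dots> = (\<Sum>w | set w \<subseteq> {1..d} \<and> length w = Suc n. refresh d a (set w) x y)"
    by (rule sum_words_Suc[symmetric]) simp
  finally show ?case .
qed

lemma matpow_cube_trans_pos:
  assumes d: "d \<ge> 1" and a: "\<forall>k\<in>{1..d}. 0 < a k \<and> a k < 1"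
    and x: "x \<in> cube d" and y: "y \<in> cube d"
    and w: "set w \<subseteq> {1..d}" "0 < refresh d a (set w) x y"
  shows "0 < matpow (cube d) (cube_trans d a (\<lambda>k. 1 / real d)) (length w) x y"
  unfolding matpow_cube_trans[OF d x y] using d w
  by (intro divide_pos_pos sum_pos2[where i = w] refresh_nonneg[OF a] finite_lists_length_eq) auto

lemma ergodic_cube:
  assumes d: "d \<ge> 1" and a: "\<forall>k\<in>{1..d}. 0 < a k \<and> a k < 1"
  shows "ergodic_chain (cube d) (point_mass (\<lambda>_. 0)) (cube_trans d a (\<lambda>k. 1 / real d))"
proof -
  let ?P = "cube_trans d a (\<lambda>k. 1 / real d)"
  have zero: "(\<lambda>_. 0) \<in> cube d" by (simp add: cube_def)
  have "distribution_on (cube d) (point_mass (\<lambda>_. 0))"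
    using zero finite_cube[of d] by (simp add: distribution_on_def point_mass_def)
  moreover have "distribution_on (cube d) (?P x)" if x: "x \<in> cube d" for x
    unfolding distribution_on_def
  proof
    show "\<forall>y\<in>cube d. 0 \<le> ?P x y"
      using cube_trans_eq_refresh[OF d x] refresh_nonneg[OF a] by (auto intro!: divide_nonneg_nonneg sum_nonneg)
    have "(\<Sum>y\<in>cube d. ?P x y) = (\<Sum>k\<in>{1..d}. \<Sum>y\<in>cube d. refresh d a {k} x y) / real d"
      using cube_trans_eq_refresh[OF d x]
      by (subst sum.swap) (simp add: sum_divide_distrib)
    then show "(\<Sum>y\<in>cube d. ?P x y) = 1"
      using d by (simp add: refresh_sum[OF x])
  qed
  \<comment> \<open>Picking each coordinate once reaches every state in \<open>d\<close> steps.\<close>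
  moreover have "\<exists>n. matpow (cube d) ?P n x y > 0" if x: "x \<in> cube d" and y: "y \<in> cube d" for x y
    using matpow_cube_trans_pos[OF d a x y, of "[1..<Suc d]"] cube_stat_pos[OF a y]
      refresh_all[of d "{1..d}" a x y]
    by (auto simp del: upt_Suc simp: atLeastLessThanSuc_atLeastAtMost)
  \<comment> \<open>A coin may reproduce the current value, so there is a loop at every state.\<close>
  moreover have "Gcd {n::nat. n > 0 \<and> matpow (cube d) ?P n x x > 0} = 1" if x: "x \<in> cube d" for x
  proof -
    have "1 \<in> {n::nat. n > 0 \<and> matpow (cube d) ?P n x x > 0}"
      using matpow_cube_trans_pos[OF d a x x, of "[1]"] refresh_self_pos[OF a x, of "{1}"] d by simp
    then have "Gcd {n::nat. n > 0 \<and> matpow (cube d) ?P n x x > 0} dvd 1"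
      by (rule Gcd_dvd)
    then show ?thesis by simp
  qed
  ultimately show ?thesis
    by (simp add: ergodic_chain_def markov_chain_def irreducible_chain_def aperiodic_chain_def finite_cube)
qed

text \<open>
  The stationary distribution is the refresh of all coordinates, which absorbs any further refresh.
\<close>

lemma stationary_cube:
  assumes d: "d \<ge> 1" and a: "\<forall>k\<in>{1..d}. 0 < a k \<and> a k < 1"
  shows "stationary_distribution (cube d) (cube_trans d a (\<lambda>k. 1 / real d)) (cube_stat d a)"
proof -
  let ?P = "cube_trans d a (\<lambda>k. 1 / real d)"
  have zero: "(\<lambda>_. 0) \<in> cube d" by (simp add: cube_def)
  have stat: "cube_stat d a y = refresh d a {1..d} (\<lambda>_. 0) y" for y
    by (simp add: refresh_all)
  have "vecmat (cube d) (cube_stat d a) ?P y = cube_stat d a y" if y: "y \<in> cube d" for y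
  proof -
    have "vecmat (cube d) (cube_stat d a) ?P y
        = (\<Sum>z\<in>cube d. \<Sum>k\<in>{1..d}. refresh d a {1..d} (\<lambda>_. 0) z * refresh d a {k} z y) / real d"
      using cube_trans_eq_refresh[OF d _ y]
      by (simp add: vecmat_def stat sum_divide_distrib sum_distrib_left)
    also have "\<dots> = (\<Sum>k\<in>{1..d}. refresh d a ({1..d} \<union> {k}) (\<lambda>_. 0) y) / real d"
      by (subst sum.swap) (simp only: refresh_comp[OF zero y])
    also have "\<dots> = (\<Sum>k\<in>{1..d}. cube_stat d a y) / real d"
      by (simp only: refresh_all[OF Un_upper1])
    finally show ?thesis using d by simp
  qed
  moreover have "distribution_on (cube d) (cube_stat d a)"
    unfolding distribution_on_def stat using refresh_nonneg[OF a] refresh_sum[OF zero] by auto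
  ultimately show ?thesis by (simp add: stationary_distribution_def)
qed

section \<open>Coupon collection\<close>

text \<open>
  The probability that \<open>n\<close> independent uniform picks from \<open>A\<close> hit every element.
\<close>

definition cover_prob :: "'b set \<Rightarrow> nat \<Rightarrow> real" where
  "cover_prob A n = real (card {w. set w = A \<and> length w = n}) / real (card A) ^ n"

text \<open>
  The complete words alone give the lower bound \<open>cover_prob\<close> for the ratio to the stationary
  distribution at every state. At the all-ones state no other word contributes, because a coordinate
  that was never picked is still 0; there the bound is attained.
\<close>

lemma sep_eq_cover_prob:
  assumes d: "d \<ge> 1" and a: "\<forall>k\<in>{1..d}. 0 < a k \<and> a k < 1"
  shows "sep (cube d)
           (vecmat (cube d) (point_mass (\<lambda>_. 0)) (matpow (cube d) (cube_trans d a (\<lambda>k. 1 / real d)) n))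
           (cube_stat d a)
       = 1 - cover_prob {1..d} n"
proof -
  let ?W = "{w. set w \<subseteq> {1..d} \<and> length w = n}"
  let ?C = "{w. set w = {1..d} \<and> length w = n}"
  let ?\<mu> = "vecmat (cube d) (point_mass (\<lambda>_. 0)) (matpow (cube d) (cube_trans d a (\<lambda>k. 1 / real d)) n)"
  have zero: "(\<lambda>_. 0) \<in> cube d" by (simp add: cube_def)
  have fin: "finite ?W" by (rule finite_lists_length_eq) simp
  have \<mu>: "?\<mu> y = (\<Sum>w\<in>?W. refresh d a (set w) (\<lambda>_. 0) y) / real d ^ n" if y: "y \<in> cube d" for y
  proof -
    have "?\<mu> y = matpow (cube d) (cube_trans d a (\<lambda>k. 1 / real d)) n (\<lambda>_. 0) y"
      using zero finite_cube[of d] unfolding vecmat_def point_mass_def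
      by (subst sum.remove[OF _ zero]) auto
    then show ?thesis by (simp add: matpow_cube_trans[OF d zero y])
  qed
  have C: "(\<Sum>w\<in>?C. refresh d a (set w) (\<lambda>_. 0) y) / real d ^ n = cover_prob {1..d} n * cube_stat d a y" for y
    by (simp add: refresh_all cover_prob_def)
  have ge: "cover_prob {1..d} n \<le> ?\<mu> y / cube_stat d a y" if y: "y \<in> cube d" for y
  proof -
    have "cover_prob {1..d} n * cube_stat d a y \<le> ?\<mu> y"
      unfolding \<mu>[OF y] C[symmetric]
      by (intro divide_right_mono sum_mono2[OF fin] refresh_nonneg[OF a]) auto
    then show ?thesis by (simp add: pos_le_divide_eq cube_stat_pos[OF a y])
  qed
  define one :: "nat \<Rightarrow> int" where "one = (\<lambda>k. of_bool (k \<in> {1..d}))"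
  have one: "one \<in> cube d" by (simp add: cube_def one_def)
  have "(\<Sum>w\<in>?W. refresh d a (set w) (\<lambda>_. 0) one) = (\<Sum>w\<in>?C. refresh d a (set w) (\<lambda>_. 0) one)"
  proof (rule sum.mono_neutral_right[OF fin], force, rule ballI)
    fix w assume "w \<in> ?W - ?C"
    then have "\<not> {1..d} \<subseteq> set w" by auto
    then obtain j where "j \<in> {1..d}" "j \<notin> set w" by blast
    then show "refresh d a (set w) (\<lambda>_. 0) one = 0"
      unfolding refresh_def one_def by (intro prod_zero) (auto intro!: bexI[of _ j])
  qed
  then have "?\<mu> one = cover_prob {1..d} n * cube_stat d a one"
    using C \<mu>[OF one] by simp
  then have eq: "?\<mu> one / cube_stat d a one = cover_prob {1..d} n"
    using cube_stat_pos[OF a one] by simp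
  show ?thesis
    unfolding sep_def
  proof (rule Max_eqI)
    show "1 - cover_prob {1..d} n \<in> (\<lambda>e. 1 - ?\<mu> e / cube_stat d a e) ` cube d"
      using one eq by force
  qed (use ge finite_cube in auto)
qed

lemma card_words_avoiding:
  assumes "finite A" "B \<subseteq> A"
  shows "(\<Sum>w | set w \<subseteq> A \<and> length w = n. of_bool (set w \<inter> B = {})) = real (card A - card B) ^ n"
proof -
  have fin: "finite {w. set w \<subseteq> A \<and> length w = n}"
    by (rule finite_lists_length_eq[OF assms(1)])
  have "(\<Sum>w | set w \<subseteq> A \<and> length w = n. of_bool (set w \<inter> B = {}))
      = real (card ({w. set w \<subseteq> A \<and> length w = n} \<inter> {w. set w \<inter> B = {}}))"
    using fin by simp
  also have "{w. set w \<subseteq> A \<and> length w = n} \<inter> {w. set w \<inter> B = {}} = {w. set w \<subseteq> A - B \<and> length w = n}"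
    by auto
  also have "real (card \<dots>) = real (card (A - B)) ^ n"
    using assms by (simp add: card_lists_length_eq)
  finally show ?thesis
    by (simp add: card_Diff_subset[OF finite_subset[OF assms(2,1)] assms(2)])
qed

text \<open>
  The first bound is the union bound: the number \<open>N\<close> of missing elements has mean \<open>m\<close> and is at least
  1 on every incomplete word. The second is Chebyshev's inequality for the event \<open>N = 0\<close>, in a
  product form that also makes sense when \<open>m = 0\<close>. It needs the variance of \<open>N\<close> to be at most \<open>m\<close>.
\<close>

lemma cover_prob_bounds:
  fixes A :: "'b set" and n :: nat
  assumes A: "finite A" "A \<noteq> {}"
  defines "m \<equiv> real (card A) * (1 - 1 / real (card A)) ^ n"
  shows "1 - m \<le> cover_prob A n" and "m * cover_prob A n \<le> 1" and "cover_prob A n \<le> 1"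
    and "0 \<le> cover_prob A n"
proof -
  define d where "d = card A"
  define W where "W = {w. set w \<subseteq> A \<and> length w = n}"
  define N where "N w = (\<Sum>j\<in>A. of_bool (set w \<inter> {j} = {}) :: real)" for w
  define C where "C = {w. set w = A \<and> length w = n}"
  have d: "d \<ge> 1" using A by (simp add: d_def Suc_le_eq card_gt_0_iff)
  have finW: "finite W" unfolding W_def by (rule finite_lists_length_eq[OF A(1)])
  have cardW: "real (card W) = real d ^ n"
    using A by (simp add: W_def d_def card_lists_length_eq)
  have CW: "C \<subseteq> W" by (auto simp: C_def W_def)
  have C0: "N w = 0" if "w \<in> C" for w using that by (auto simp: C_def N_def)
  have C1: "1 \<le> N w" if w: "w \<in> W - C" for w
  proof -
    from w obtain j where "j \<in> A" "j \<notin> set w" by (auto simp: W_def C_def)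
    then show ?thesis
      unfolding N_def using A member_le_sum[of j A "\<lambda>j. of_bool (set w \<inter> {j} = {}) :: real"] by simp
  qed
  have dm: "m * real d ^ n = real d * real (d - 1) ^ n"
    using d by (simp add: m_def d_def[symmetric] of_nat_diff power_mult_distrib[symmetric] field_simps)
  have m0: "0 \<le> m" using d by (simp add: m_def d_def[symmetric])
  have first: "(\<Sum>w\<in>W. N w) = m * real d ^ n"
  proof -
    have "(\<Sum>w\<in>W. N w) = (\<Sum>j\<in>A. \<Sum>w\<in>W. of_bool (set w \<inter> {j} = {}))"
      unfolding N_def by (rule sum.swap)
    also have "\<dots> = (\<Sum>j\<in>A. real (d - card {j}) ^ n)"
      unfolding W_def d_def by (intro sum.cong refl card_words_avoiding A) auto
    finally show ?thesis using dm by (simp add: d_def)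
  qed
  have second: "(\<Sum>w\<in>W. (N w)\<^sup>2) \<le> m * real d ^ n + m\<^sup>2 * real d ^ n"
  proof -
    \<comment> \<open>\<open>q\<close> is the number of words that would miss two given elements if missing them were
      independent events; the actual number \<open>(d - 2)\<^sup>n\<close> does not exceed it.\<close>
    define q where "q = real (d - 1) ^ (2 * n) / real d ^ n"
    have q0: "0 \<le> q" by (simp add: q_def)
    have q: "real (d - 2) ^ n \<le> q"
    proof -
      have "real (d - 2) * real d \<le> (real (d - 1))\<^sup>2"
      proof (cases "d \<ge> 2")
        case True
        then show ?thesis by (simp add: of_nat_diff power2_eq_square algebra_simps)
      qed simp
      then have "(real (d - 2) * real d) ^ n \<le> ((real (d - 1))\<^sup>2) ^ n"
        by (intro power_mono) auto
      then show ?thesis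
        using d by (simp add: q_def pos_le_divide_eq power_mult_distrib power_mult)
    qed
    have sq: "(N w)\<^sup>2 = (\<Sum>j\<in>A. \<Sum>k\<in>A. of_bool (set w \<inter> {j, k} = {}))" for w
      unfolding N_def power2_eq_square sum_product by (intro sum.cong refl) auto
    have "(\<Sum>w\<in>W. (N w)\<^sup>2) = (\<Sum>j\<in>A. \<Sum>w\<in>W. \<Sum>k\<in>A. of_bool (set w \<inter> {j, k} = {}))"
      unfolding sq by (rule sum.swap)
    also have "\<dots> = (\<Sum>j\<in>A. \<Sum>k\<in>A. \<Sum>w\<in>W. of_bool (set w \<inter> {j, k} = {}))"
      by (intro sum.cong refl sum.swap)
    also have "\<dots> = (\<Sum>j\<in>A. \<Sum>k\<in>A. real (d - card {j, k}) ^ n)"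
      unfolding W_def d_def by (intro sum.cong refl card_words_avoiding A) auto
    also have "\<dots> \<le> (\<Sum>j\<in>A. \<Sum>k\<in>A. (if j = k then real (d - 1) ^ n else 0) + q)"
      using q q0 by (intro sum_mono) (auto simp: numeral_2_eq_2)
    also have "\<dots> = real d * real (d - 1) ^ n + real d * (real d * q)"
      using A by (simp add: sum.distrib d_def distrib_left)
    also have "real d * (real d * q) = (m * real d ^ n)\<^sup>2 / real d ^ n"
      by (simp add: dm q_def power2_eq_square power_mult power_mult_distrib mult_ac)
    also have "\<dots> = m\<^sup>2 * real d ^ n"
      using d by (simp add: power2_eq_square)
    finally show ?thesis by (simp add: dm)
  qed
  have F: "cover_prob A n = real (card C) / real d ^ n"
    by (simp add: cover_prob_def C_def d_def)
  show "0 \<le> cover_prob A n" by (simp add: F)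
  have "real (card C) \<le> real (card W)" using card_mono[OF finW CW] by simp
  then show "cover_prob A n \<le> 1" using d by (simp add: F cardW)
  have "real d ^ n - real (card C) = (\<Sum>w\<in>W - C. 1)"
    using card_mono[OF finW CW] by (simp add: card_Diff_subset[OF finite_subset[OF CW finW] CW] of_nat_diff cardW)
  also have "\<dots> \<le> (\<Sum>w\<in>W - C. N w)" by (intro sum_mono C1)
  also have "\<dots> \<le> (\<Sum>w\<in>W. N w)"
    by (intro sum_mono2[OF finW]) (auto simp: N_def intro: sum_nonneg)
  finally show "1 - m \<le> cover_prob A n"
    using d by (simp add: first F field_simps)
  have "m\<^sup>2 * real (card C) = (\<Sum>w\<in>C. (N w - m)\<^sup>2)" using C0 by simp
  also have "\<dots> \<le> (\<Sum>w\<in>W. (N w - m)\<^sup>2)" by (intro sum_mono2[OF finW CW]) auto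
  also have "\<dots> = (\<Sum>w\<in>W. (N w)\<^sup>2) - 2 * m * (\<Sum>w\<in>W. N w) + m\<^sup>2 * real d ^ n"
    by (simp add: power2_diff sum.distrib sum_subtractf cardW sum_distrib_left sum_distrib_right mult_ac)
  also have "\<dots> \<le> m * real d ^ n"
    using second by (simp add: first power2_eq_square algebra_simps)
  finally have "m * (m * real (card C)) \<le> m * real d ^ n" by (simp add: power2_eq_square mult_ac)
  then have "m * real (card C) \<le> real d ^ n"
    using m0 by (cases "m = 0") auto
  then show "m * cover_prob A n \<le> 1" using d by (simp add: F)
qed

section \<open>The cutoff\<close>

text \<open>
  Rounding the exponent changes it by at most 1, which multiplies the value by at most
  \<open>1 / (1 - 1/d)\<close>; both envelopes below therefore have the same limit.
\<close>

lemma expected_missing_tendsto: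
  fixes c :: real
  shows "(\<lambda>d. real d * (1 - 1 / real d) ^ nat \<lfloor>real d * ln (real d) + c * real d\<rfloor>) \<longlonglongrightarrow> exp (- c)"
proof (rule tendsto_sandwich)
  show "(\<lambda>d. real d * (1 - 1 / real d) powr (real d * ln (real d) + c * real d)) \<longlonglongrightarrow> exp (- c)"
    by real_asymp
  show "(\<lambda>d. real d * (1 - 1 / real d) powr (real d * ln (real d) + c * real d - 1)) \<longlonglongrightarrow> exp (- c)"
    by real_asymp
  have large: "\<forall>\<^sub>F d in sequentially. real d * ln (real d) + c * real d > 0"
    by real_asymp
  have *: "\<forall>\<^sub>F d in sequentially. 1 < d \<and> real d * ln (real d) + c * real d > 0"
    using large eventually_gt_at_top[of 1] by (simp add: eventually_conj_iff)
  show "\<forall>\<^sub>F d in sequentially. real d * (1 - 1 / real d) powr (real d * ln (real d) + c * real d)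
         \<le> real d * (1 - 1 / real d) ^ nat \<lfloor>real d * ln (real d) + c * real d\<rfloor>"
    using *
  proof eventually_elim
    case (elim d)
    then have "(1 - 1 / real d) ^ nat \<lfloor>real d * ln (real d) + c * real d\<rfloor>
        = (1 - 1 / real d) powr real (nat \<lfloor>real d * ln (real d) + c * real d\<rfloor>)"
      by (subst powr_realpow) simp_all
    also have "\<dots> \<ge> (1 - 1 / real d) powr (real d * ln (real d) + c * real d)"
      using elim by (intro powr_mono') auto
    finally show ?case by (intro mult_left_mono) auto
  qed
  show "\<forall>\<^sub>F d in sequentially. real d * (1 - 1 / real d) ^ nat \<lfloor>real d * ln (real d) + c * real d\<rfloor>
         \<le> real d * (1 - 1 / real d) powr (real d * ln (real d) + c * real d - 1)"
    using *
  proof eventually_elim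
    case (elim d)
    then have "(1 - 1 / real d) ^ nat \<lfloor>real d * ln (real d) + c * real d\<rfloor>
        = (1 - 1 / real d) powr real (nat \<lfloor>real d * ln (real d) + c * real d\<rfloor>)"
      by (subst powr_realpow) simp_all
    also have "\<dots> \<le> (1 - 1 / real d) powr (real d * ln (real d) + c * real d - 1)"
      using elim by (intro powr_mono') (linarith, simp_all)
    finally show ?case by (intro mult_left_mono) auto
  qed
qed

theorem corollary4p12:
  fixes a :: "nat \<Rightarrow> nat \<Rightarrow> real"
  assumes "\<And>d k. 1 \<le> k \<Longrightarrow> k \<le> d \<Longrightarrow> 0 < a d k \<and> a d k < 1"
  shows "separation_cutoff
           cube
           (\<lambda>d. point_mass (\<lambda>_. 0))
           (\<lambda>d. cube_trans d (a d) (\<lambda>k. 1 / real d))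
           (\<lambda>d. cube_stat d (a d))
           (\<lambda>d. real d * ln (real d))
           (\<lambda>d. real d)"
proof -
  have a: "\<forall>k\<in>{1..d}. 0 < a d k \<and> a d k < 1" for d using assms by auto
  define s where "s c d = sep_at (cube d) (point_mass (\<lambda>_. 0)) (cube_trans d (a d) (\<lambda>k. 1 / real d))
      (cube_stat d (a d)) (real d * ln (real d) + c * real d)" for c d
  define m where "m c d = real d * (1 - 1 / real d) ^ nat \<lfloor>real d * ln (real d) + c * real d\<rfloor>" for c d
  have m_lim: "m c \<longlonglongrightarrow> exp (- c)" for c
    unfolding m_def by (rule expected_missing_tendsto)
  have s_bounds: "0 \<le> s c d" "s c d \<le> 1" "s c d \<le> m c d" "m c d * (1 - s c d) \<le> 1" if d: "1 \<le> d" for c d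
    using cover_prob_bounds[of "{1..d}" "nat \<lfloor>real d * ln (real d) + c * real d\<rfloor>"] d
    by (simp_all add: s_def m_def sep_at_def sep_eq_cover_prob[OF d a])
  have upper: "limsup (\<lambda>d. ereal (s c d)) \<le> ereal (exp (- c))" for c
  proof -
    have "limsup (\<lambda>d. ereal (s c d)) \<le> limsup (\<lambda>d. ereal (m c d))"
      by (rule Limsup_mono) (auto intro!: eventually_mono[OF eventually_ge_at_top[of 1]] s_bounds)
    also have "\<dots> = ereal (exp (- c))"
      by (rule lim_imp_Limsup) (auto intro: m_lim)
    finally show ?thesis .
  qed
  have upper0: "0 \<le> limsup (\<lambda>d. ereal (s c d))" for c
    by (rule le_Limsup) (auto intro!: eventually_mono[OF eventually_ge_at_top[of 1]] s_bounds)
  have lower: "ereal (1 - exp (- c)) \<le> liminf (\<lambda>d. ereal (s (- c) d))" for c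
  proof -
    have "(\<lambda>d. 1 - inverse (m (- c) d)) \<longlonglongrightarrow> 1 - inverse (exp (- (- c)))"
      by (intro tendsto_intros m_lim) auto
    then have "(\<lambda>d. ereal (1 - inverse (m (- c) d))) \<longlonglongrightarrow> ereal (1 - exp (- c))"
      by (simp add: exp_minus)
    then have "ereal (1 - exp (- c)) = liminf (\<lambda>d. ereal (1 - inverse (m (- c) d)))"
      by (intro lim_imp_Liminf[symmetric]) auto
    also have "\<dots> \<le> liminf (\<lambda>d. ereal (s (- c) d))"
    proof (rule Liminf_mono)
      have "\<forall>\<^sub>F d in sequentially. m (- c) d > 0"
        using order_tendstoD(1)[OF m_lim[of "- c"], of 0] by simp
      with eventually_ge_at_top[of 1]
      show "\<forall>\<^sub>F d in sequentially. ereal (1 - inverse (m (- c) d)) \<le> ereal (s (- c) d)"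
      proof eventually_elim
        case (elim d)
        then show ?case using s_bounds(4)[of d "- c"] by (simp add: field_simps)
      qed
    qed
    finally show ?thesis .
  qed
  have lower1: "liminf (\<lambda>d. ereal (s c d)) \<le> 1" for c
    by (rule Liminf_le) (auto intro!: eventually_mono[OF eventually_ge_at_top[of 1]] s_bounds)
  have e0: "((\<lambda>c::real. ereal (exp (- c))) \<longlongrightarrow> 0) at_top"
    unfolding zero_ereal_def lim_ereal by real_asymp
  have e1: "((\<lambda>c::real. ereal (1 - exp (- c))) \<longlongrightarrow> 1) at_top"
    unfolding one_ereal_def lim_ereal by real_asymp
  have "((\<lambda>c. limsup (\<lambda>d. ereal (s c d))) \<longlongrightarrow> 0) at_top"
    by (rule tendsto_sandwich[OF _ _ tendsto_const e0]) (simp_all add: upper upper0)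
  moreover have "((\<lambda>c. liminf (\<lambda>d. ereal (s (- c) d))) \<longlongrightarrow> 1) at_top"
    by (rule tendsto_sandwich[OF _ _ e1 tendsto_const]) (simp_all add: lower lower1)
  moreover have "(\<lambda>d. real d) \<in> o(\<lambda>d. real d * ln (real d))"
    by real_asymp
  ultimately show ?thesis
    unfolding separation_cutoff_def s_def
    using ergodic_cube[OF _ a] stationary_cube[OF _ a] by simp
qed

end
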